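(* Let $d\ge2$. Every function in $H^2(\mathcal{B})$ belongs to $C^\infty(\mathcal{B})$.
   Context: $\mathbb{D}=\{z\in\mathbb{C}:|z|<1\}$; $\mathbb{S}^{d-1}$ is the unit sphere of $\mathbb{R}^d$ with rotation-invariant measure $d\theta$. $\mathcal{H}_k(\mathbb{R}^d)$ is the space of harmonic homogeneous polynomials of degree $k$, $a_k=\dim\mathcal{H}_k(\mathbb{R}^d)$, and $Y_{k,\ell}$ ($\ell=1,\dots,a_k$) is a fixed basis of $\mathcal{H}_k(\mathbb{R}^d)$ orthonormal for $\int_{\mathbb{S}^{d-1}}f\overline g\,d\theta$. $\mathcal{B}=\mathbb{D}\times\mathbb{S}^{d-1}/\mathbb{Z}_2$ is the unit ball of the Klein-Dirac quadric, where $(z,\theta)$ and $(-z,-\theta)$ are identified; $C^\infty(\mathcal{B})$ is the space of smooth functions on this quotient manifold, i.e. smooth functions of $(z,\theta)\in\mathbb{D}\times\mathbb{S}^{d-1}$ invariant under $(z,\theta)\mapsto(-z,-\theta)$. The polyharmonic Hardy space $H^2(\mathcal{B})$ consists of the functions $f(z,\theta)=\sum_{k=0}^{\infty}\sum_{\ell=1}^{a_k}\sum_{j=0}^{\infty}f_{k,\ell;j}z^{k+2j}Y_{k,\ell}(\theta)$ on $|z|<1$, $\theta\in\mathbb{S}^{d-1}$, with $\sum_{k,\ell,j}|f_{k,\ell;j}|^2<\infty$. *)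

theory Defs
  imports "HOL-Analysis.Analysis" "HOL-Library.Function_Algebras"
begin

text \<open>For open \<open>U\<close>; since the domain is finite-dimensional, continuity of the iterated derivatives
  in fixed directions is continuity of the derivatives as multilinear maps.\<close>

fun C_k_on :: "nat \<Rightarrow> 'a::euclidean_space set \<Rightarrow> ('a \<Rightarrow> 'b::euclidean_space) \<Rightarrow> bool" where
  "C_k_on 0 U f \<longleftrightarrow> continuous_on U f"
| "C_k_on (Suc n) U f \<longleftrightarrow>
     (\<forall>x\<in>U. f differentiable (at x)) \<and>
     (\<forall>v. C_k_on n U (\<lambda>x. frechet_derivative f (at x) v))"

definition C_inf_on :: "'a::euclidean_space set \<Rightarrow> ('a \<Rightarrow> 'b::euclidean_space) \<Rightarrow> bool" where
  "C_inf_on U f \<longleftrightarrow> (\<forall>n. C_k_on n U f)"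

text \<open>For an embedded submanifold \<open>M\<close> of a Euclidean space, a function is smooth on the
  manifold \<open>M\<close> iff it extends, locally around each point of \<open>M\<close>, to a smooth function on an
  open set of the ambient space.\<close>

definition smooth_on_submanifold :: "'a::euclidean_space set \<Rightarrow> ('a \<Rightarrow> 'b::euclidean_space) \<Rightarrow> bool"
  where
  "smooth_on_submanifold M f \<longleftrightarrow>
     (\<forall>x\<in>M. \<exists>U F. open U \<and> x \<in> U \<and> C_inf_on U F \<and> (\<forall>y\<in>U \<inter> M. F y = f y))"

text \<open>Functions on the quotient of \<open>ball 0 1 \<times> sphere 0 1\<close> by the free involution
  \<open>(z, \<theta>) \<mapsto> (-z, -\<theta>)\<close> are represented by invariant functions on the product; their values
  elsewhere on \<open>complex \<times> (real^'n)\<close> are irrelevant.\<close>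

definition C_inf_klein_dirac :: "(complex \<times> (real^'n) \<Rightarrow> complex) set" where
  "C_inf_klein_dirac =
     {f. smooth_on_submanifold (ball 0 1 \<times> sphere 0 1) f \<and>
         (\<forall>z\<in>ball 0 1. \<forall>\<theta>\<in>sphere 0 1. f (- z, - \<theta>) = f (z, \<theta>))}"

definition cscale :: "complex \<Rightarrow> ('a \<Rightarrow> complex) \<Rightarrow> 'a \<Rightarrow> complex" where
  "cscale c f = (\<lambda>x. c * f x)"

global_interpretation cfun: vector_space cscale
  by unfold_locales (auto simp: cscale_def fun_eq_iff algebra_simps)

definition monomial_fun :: "('n::finite \<Rightarrow> nat) \<Rightarrow> real^'n \<Rightarrow> complex" where
  "monomial_fun \<alpha> x = (\<Prod>i\<in>UNIV. of_real (x $ i) ^ \<alpha> i)"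

definition homogeneous_polys :: "nat \<Rightarrow> (real^'n::finite \<Rightarrow> complex) set" where
  "homogeneous_polys k = cfun.span {monomial_fun \<alpha> | \<alpha>. (\<Sum>i\<in>UNIV. \<alpha> i) = k}"

definition partial :: "'n::finite \<Rightarrow> (real^'n \<Rightarrow> complex) \<Rightarrow> real^'n \<Rightarrow> complex" where
  "partial i f x = frechet_derivative f (at x) (axis i 1)"

definition laplacian :: "(real^'n::finite \<Rightarrow> complex) \<Rightarrow> real^'n \<Rightarrow> complex" where
  "laplacian f x = (\<Sum>i\<in>UNIV. partial i (partial i f) x)"

definition harmonic_polys :: "nat \<Rightarrow> (real^'n::finite \<Rightarrow> complex) set" where
  "harmonic_polys k = {p \<in> homogeneous_polys k. \<forall>x. laplacian p x = 0}"

definition harmonic_dim :: "'n::finite itself \<Rightarrow> nat \<Rightarrow> nat" where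
  "harmonic_dim _ k = cfun.dim (harmonic_polys k :: (real^'n \<Rightarrow> complex) set)"

text \<open>Such a measure is unique up to a positive factor; the normalisation is left open.\<close>

definition rotation_invariant_sphere_measure :: "(real^'n::finite) measure \<Rightarrow> bool" where
  "rotation_invariant_sphere_measure \<sigma> \<longleftrightarrow>
     sets \<sigma> = sets (restrict_space borel (sphere 0 1)) \<and>
     finite_measure \<sigma> \<and> emeasure \<sigma> (space \<sigma>) \<noteq> 0 \<and>
     (\<forall>T. orthogonal_transformation T \<and> det (matrix T) = 1 \<longrightarrow> distr \<sigma> \<sigma> T = \<sigma>)"

definition harmonic_orthonormal_basis ::
    "(real^'n::finite) measure \<Rightarrow> nat \<Rightarrow> (nat \<Rightarrow> real^'n \<Rightarrow> complex) \<Rightarrow> bool" where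
  "harmonic_orthonormal_basis \<sigma> k Y \<longleftrightarrow>
     (let I = {1..harmonic_dim TYPE('n) k} in
       inj_on Y I \<and> cfun.independent (Y ` I) \<and> cfun.span (Y ` I) = harmonic_polys k \<and>
       (\<forall>l\<in>I. \<forall>m\<in>I. (LINT \<theta>|\<sigma>. Y l \<theta> * cnj (Y m \<theta>)) = (if l = m then 1 else 0)))"

text \<open>Square summability of the coefficients makes the series below converge for
  \<open>norm z < 1\<close> and \<open>norm \<theta> = 1\<close>, so no separate convergence requirement is imposed.\<close>

definition polyharmonic_hardy ::
    "(nat \<Rightarrow> nat \<Rightarrow> real^'n::finite \<Rightarrow> complex) \<Rightarrow> (complex \<times> (real^'n) \<Rightarrow> complex) set" where
  "polyharmonic_hardy Y =
     {f. \<exists>c :: nat \<Rightarrow> nat \<Rightarrow> nat \<Rightarrow> complex.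
        (\<lambda>(k, l, j). (norm (c k l j))\<^sup>2) summable_on {(k, l, j). l \<in> {1..harmonic_dim TYPE('n) k}} \<and>
        (\<forall>z\<in>ball 0 1. \<forall>\<theta>\<in>sphere 0 1.
           f (z, \<theta>) = (\<Sum>k. \<Sum>l = 1..harmonic_dim TYPE('n) k. \<Sum>j. c k l j * z ^ (k + 2 * j) * Y k l \<theta>))}"

end

theory Submission
  imports Defs "HOL-Complex_Analysis.Cauchy_Integral_Formula"
begin

text \<open>The terms \<open>z ^ (k + 2 * j) * Y k l x\<close> are polynomials on the ambient space, and the series is
  extended to it as written. Near a point with \<open>norm z < 1\<close>, \<open>norm x = 1\<close> one has \<open>norm z * norm x < 1\<close>,
  so the terms decay geometrically in \<open>k + j\<close> once \<open>Y k l\<close> is bounded on the sphere polynomially in \<open>k\<close>.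
  Bernstein's inequality \<open>norm (D p x v) \<le> 2 * (d + 1)\<^sup>2 * M / s * norm v\<close>, for polynomials of degree at
  most \<open>d\<close> bounded by \<open>M\<close> on the ball of radius \<open>s\<close> around \<open>x\<close>, is used twice: it makes all termwise
  derivatives summable, and it gives the sup bound on the sphere from the normalisation in
  \<open>L\<^sup>2\<close>.\<close>

section \<open>Bernstein's inequality in one variable\<close>

lemma higher_deriv_poly: "(deriv ^^ m) (poly (T :: complex poly)) = poly ((pderiv ^^ m) T)"
proof (induction m)
  case (Suc m)
  have "deriv (poly S) = poly (pderiv S)" for S :: "complex poly"
    by (rule ext, rule DERIV_imp_deriv, rule poly_DERIV)
  then show ?case
    using Suc by simp
qed simp

text \<open>Cauchy's estimate on the unit circle, since the \<open>m\<close>-th derivative at 0 is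
  \<open>fact m\<close> times the coefficient.\<close>

lemma norm_coeff_le_of_norm_le_on_circle:
  fixes T :: "complex poly"
  assumes "\<And>w. norm w = 1 \<Longrightarrow> norm (poly T w) \<le> M"
  shows "norm (coeff T m) \<le> M"
proof -
  have "norm ((deriv ^^ m) (poly T) 0) \<le> fact m * M / 1 ^ m"
    by (rule Cauchy_inequality)
      (use assms in \<open>auto intro!: holomorphic_intros continuous_intros\<close>)
  moreover have "(deriv ^^ m) (poly T) 0 = fact m * coeff T m"
    by (simp add: higher_deriv_poly poly_0_coeff_0 coeff_higher_pderiv pochhammer_fact)
  ultimately show ?thesis
    by (simp add: norm_mult)
qed

text \<open>On the unit circle \<open>w = cis t\<close> the auxiliary polynomial \<open>T w = w ^ d * q ((w - 1 / w) / (2 * \<i>))\<close>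
  has modulus \<open>norm (q (sin t))\<close>, so its coefficients are at most \<open>M\<close>.\<close>

lemma bernstein_at_zero:
  fixes q :: "complex poly"
  assumes deg: "degree q \<le> d"
    and bound: "\<And>t::real. \<bar>t\<bar> \<le> 1 \<Longrightarrow> norm (poly q (of_real t)) \<le> M"
  shows "norm (poly (pderiv q) 0) \<le> 2 * (real d + 1)\<^sup>2 * M"
proof -
  \<comment> \<open>Each power \<open>(w - 1 / w) ^ j\<close> equals
    \<open>(w ^ 2 - 1) ^ j / w ^ j\<close>, and \<open>w ^ d\<close> clears the denominator because
    \<open>j \<le> d\<close>. The factor \<open>[:-1, 0, 1:]\<close> is
    \<open>w ^ 2 - 1\<close>.\<close>
  define T where
    "T = (\<Sum>j\<le>d. smult (coeff q j / (2 * \<i>) ^ j) (monom 1 (d - j) * [:-1, 0, 1:] ^ j))"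
  have degT: "degree T \<le> 2 * d"
    unfolding T_def
  proof (rule degree_sum_le)
    fix j assume j: "j \<in> {..d}"
    have "degree (monom (1::complex) (d - j) * [:-1, 0, 1:] ^ j) \<le> (d - j) + 2 * j"
      by (intro order.trans[OF degree_mult_le] add_mono order.trans[OF degree_power_le])
        (auto simp: degree_monom_eq)
    also have "\<dots> \<le> 2 * d"
      using j by auto
    finally show "degree (smult (coeff q j / (2 * \<i>) ^ j) (monom 1 (d - j) * [:-1, 0, 1:] ^ j)) \<le> 2 * d"
      using degree_smult_le order.trans by blast
  qed simp
  have T_eq: "poly T w = w ^ d * poly q ((w - 1 / w) / (2 * \<i>))" if "w \<noteq> 0" for w
  proof -
    have "poly T w = (\<Sum>j\<le>d. coeff q j / (2 * \<i>) ^ j * (w ^ (d - j) * (w\<^sup>2 - 1) ^ j))"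
      by (simp add: T_def poly_sum poly_monom power2_eq_square mult_ac)
    also have "\<dots> = (\<Sum>j\<le>d. w ^ d * (coeff q j * ((w - 1 / w) / (2 * \<i>)) ^ j))"
    proof (rule sum.cong)
      fix j assume "j \<in> {..d}"
      then have "w ^ d = w ^ (d - j) * w ^ j"
        by (simp flip: power_add)
      moreover have "w - 1 / w = (w\<^sup>2 - 1) / w"
        using that by (simp add: field_simps power2_eq_square)
      ultimately show "coeff q j / (2 * \<i>) ^ j * (w ^ (d - j) * (w\<^sup>2 - 1) ^ j) =
          w ^ d * (coeff q j * ((w - 1 / w) / (2 * \<i>)) ^ j)"
        using that by (simp only: power_divide power_mult_distrib) (simp add: field_simps)
    qed simp
    also have "\<dots> = w ^ d * poly q ((w - 1 / w) / (2 * \<i>))"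
      unfolding poly_altdef[of q] sum_distrib_left[symmetric]
      using deg by (intro arg_cong[where f = "\<lambda>x. w ^ d * x"] sum.mono_neutral_right)
        (auto simp: coeff_eq_0)
    finally show ?thesis .
  qed
  have "norm (poly T w) \<le> M" if w: "norm w = 1" for w
  proof -
    have "w \<noteq> 0" using w by auto
    obtain t where t: "w = cis t"
      using w by (metis cis_Arg norm_zero rcis_cmod_Arg rcis_def mult_1 of_real_1)
    have "(w - 1 / w) / (2 * \<i>) = of_real (sin t)"
      by (auto simp: t complex_eq_iff simp flip: cis_inverse inverse_eq_divide)
    then show ?thesis
      using T_eq[OF \<open>w \<noteq> 0\<close>] bound[of "sin t"] w by (simp add: norm_mult norm_power)
  qed
  then have coeff_le: "norm (coeff T m) \<le> M" for m
    by (rule norm_coeff_le_of_norm_le_on_circle)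
  \<comment> \<open>The point \<open>w = 1\<close> corresponds to the argument 0 of
    \<open>q\<close>: the inner function vanishes there and has derivative
    \<open>1 / \<i>\<close>.\<close>
  have "((\<lambda>w. w ^ d * poly q ((w - 1 / w) / (2 * \<i>))) has_field_derivative
      of_nat d * poly q 0 + poly (pderiv q) 0 / \<i>) (at 1)"
    by (auto intro!: derivative_eq_intros DERIV_chain2[OF poly_DERIV] simp: power2_eq_square)
  moreover have "((\<lambda>w. w ^ d * poly q ((w - 1 / w) / (2 * \<i>))) has_field_derivative poly (pderiv T) 1) (at 1)"
  proof (rule has_field_derivative_transform_within_open[OF poly_DERIV])
    show "open (- {0::complex})" by auto
  qed (auto simp: T_eq)
  ultimately have "poly (pderiv T) 1 = of_nat d * poly q 0 + poly (pderiv q) 0 / \<i>"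
    by (rule DERIV_unique[symmetric])
  moreover have "poly q 0 = poly T 1"
    using T_eq[of 1] by simp
  ultimately have "poly (pderiv q) 0 = \<i> * (poly (pderiv T) 1 - of_nat d * poly T 1)"
    by simp
  \<comment> \<open>Removing the \<open>q 0\<close> term shifts the weights from \<open>m\<close> to
    \<open>m - d\<close>, which is at most \<open>d\<close> in modulus for
    \<open>m \<le> 2 * d\<close>. The \<open>2 * d + 1\<close> coefficients then contribute at most
    \<open>(2 * d + 1) * d * M\<close>.\<close>
  moreover have "poly (pderiv T) 1 - of_nat d * poly T 1 = (\<Sum>m\<le>2*d. (of_nat m - of_nat d) * coeff T m)"
  proof -
    have T': "T = (\<Sum>m\<le>2*d. monom (coeff T m) m)"
      using degT by (simp add: poly_as_sum_of_monoms')
    have "poly (pderiv T) 1 = (\<Sum>m\<le>2*d. of_nat m * coeff T m)"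
      by (subst T') (simp add: higher_pderiv_sum[where n = 1, simplified] poly_sum pderiv_monom poly_monom)
    moreover have "poly T 1 = (\<Sum>m\<le>2*d. coeff T m)"
      by (subst T') (simp add: poly_sum poly_monom)
    ultimately show ?thesis
      by (simp add: sum_distrib_left algebra_simps sum_subtractf)
  qed
  ultimately have "norm (poly (pderiv q) 0) = norm (\<Sum>m\<le>2*d. (of_nat m - of_nat d) * coeff T m)"
    by (simp add: norm_mult)
  also have "\<dots> \<le> (\<Sum>m\<le>2*d. real d * M)"
  proof (rule sum_norm_le)
    fix m assume m: "m \<in> {..2*d}"
    have "norm (of_nat m - of_nat d :: complex) = \<bar>real m - real d\<bar>"
      by (metis norm_of_real of_real_diff of_real_of_nat_eq)
    also have "\<dots> \<le> real d"
      using m by auto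
    finally show "norm ((of_nat m - of_nat d) * coeff T m) \<le> real d * M"
      unfolding norm_mult using coeff_le[of m] by (intro mult_mono) auto
  qed
  also have "\<dots> = (2 * real d + 1) * real d * M"
    by (simp add: algebra_simps)
  also have "\<dots> \<le> 2 * (real d + 1)\<^sup>2 * M"
    using order.trans[OF norm_ge_zero coeff_le[of 0]]
    by (intro mult_right_mono) (auto simp: power2_eq_square algebra_simps)
  finally show ?thesis .
qed

section \<open>Polynomial functions on normed spaces\<close>

text \<open>The number is only an upper bound for the degree. Bounded real-linear maps take the
  place of coordinates, so one notion covers polynomials on \<open>real^'n\<close> as well as those
  on \<open>complex \<times> (real^'n)\<close>, where the projection to \<open>z\<close> is itself
  linear.\<close>

inductive poly_deg :: "nat \<Rightarrow> ('a::real_normed_vector \<Rightarrow> complex) \<Rightarrow> bool" where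
  const: "poly_deg 0 (\<lambda>_. c)"
| linear: "bounded_linear h \<Longrightarrow> poly_deg 1 h"
| add: "poly_deg d f \<Longrightarrow> poly_deg d g \<Longrightarrow> poly_deg d (\<lambda>x. f x + g x)"
| mult: "poly_deg d f \<Longrightarrow> poly_deg e g \<Longrightarrow> poly_deg (d + e) (\<lambda>x. f x * g x)"
| mono: "poly_deg d f \<Longrightarrow> d \<le> e \<Longrightarrow> poly_deg e f"

text \<open>Restriction to a line is what carries the one-variable Bernstein inequality over to
  several variables.\<close>

lemma poly_deg_along_line:
  assumes "poly_deg d p"
  shows "\<exists>q. degree q \<le> d \<and> (\<forall>t. p (x + t *\<^sub>R v) = poly q (of_real t))"
  using assms
proof (induction rule: poly_deg.induct)
  case (const c)
  show ?case by (rule exI[of _ "[:c:]"]) simp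
next
  case (linear h)
  then show ?case
    by (intro exI[of _ "[:h x, h v:]"])
      (auto simp: bounded_linear.axioms linear_simps scaleR_conv_of_real)
next
  case (add d f g)
  then obtain q r where "degree q \<le> d" "\<And>t. f (x + t *\<^sub>R v) = poly q (of_real t)"
    "degree r \<le> d" "\<And>t. g (x + t *\<^sub>R v) = poly r (of_real t)" by auto
  then show ?case
    by (intro exI[of _ "q + r"]) (auto intro: degree_add_le)
next
  case (mult d f e g)
  then obtain q r where "degree q \<le> d" "\<And>t. f (x + t *\<^sub>R v) = poly q (of_real t)"
    "degree r \<le> e" "\<And>t. g (x + t *\<^sub>R v) = poly r (of_real t)" by auto
  then show ?case
    by (intro exI[of _ "q * r"]) (auto intro!: order.trans[OF degree_mult_le] add_mono)
next
  case (mono d f e)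
  then show ?case by (meson order.trans)
qed

text \<open>Keeping the same bound \<open>d\<close> for the derivative lets the degrees in a series
  stay fixed under repeated termwise differentiation.\<close>

lemma poly_deg_has_derivative:
  assumes "poly_deg d p"
  shows "\<exists>p'. (\<forall>x. (p has_derivative p' x) (at x)) \<and> (\<forall>v. poly_deg d (\<lambda>x. p' x v))"
  using assms
proof (induction rule: poly_deg.induct)
  case (const c)
  show ?case
    by (rule exI[of _ "\<lambda>x v. 0"]) (auto intro: poly_deg.const)
next
  case (linear h)
  then show ?case
    by (intro exI[of _ "\<lambda>x. h"])
      (auto intro: bounded_linear_imp_has_derivative poly_deg.const poly_deg.mono)
next
  case (add d f g)
  then obtain f' g' where "\<And>x. (f has_derivative f' x) (at x)" "\<And>v. poly_deg d (\<lambda>x. f' x v)"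
    "\<And>x. (g has_derivative g' x) (at x)" "\<And>v. poly_deg d (\<lambda>x. g' x v)" by auto
  then show ?case
    by (intro exI[of _ "\<lambda>x v. f' x v + g' x v"]) (auto intro: poly_deg.add has_derivative_add)
next
  case (mult d f e g)
  then obtain f' g' where D: "\<And>x. (f has_derivative f' x) (at x)" "\<And>v. poly_deg d (\<lambda>x. f' x v)"
    "\<And>x. (g has_derivative g' x) (at x)" "\<And>v. poly_deg e (\<lambda>x. g' x v)" by auto
  have "poly_deg (d + e) (\<lambda>x. f x * g' x v + f' x v * g x)" for v
    by (intro poly_deg.add poly_deg.mult mult.hyps D)
  with D(1,3) show ?case
    by (intro exI[of _ "\<lambda>x v. f x * g' x v + f' x v * g x"]) (auto intro: has_derivative_mult)
next
  case (mono d f e)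
  then show ?case by (meson poly_deg.mono)
qed

lemma poly_deg_differentiable: "poly_deg d p \<Longrightarrow> p differentiable (at x)"
  using poly_deg_has_derivative differentiableI by blast

lemma poly_deg_frechet_derivative:
  assumes "poly_deg d p"
  shows "poly_deg d (\<lambda>x. frechet_derivative p (at x) v)"
proof -
  obtain p' where p': "\<And>x. (p has_derivative p' x) (at x)" "\<And>v. poly_deg d (\<lambda>x. p' x v)"
    using poly_deg_has_derivative[OF assms] by blast
  have "frechet_derivative p (at x) = p' x" for x
    using p'(1) frechet_derivative_at by metis
  then show ?thesis using p'(2) by simp
qed

lemma poly_deg_continuous_on: "poly_deg d p \<Longrightarrow> continuous_on S p"
  by (meson continuous_at_imp_continuous_on differentiable_imp_continuous_within
      poly_deg_differentiable)

lemma poly_deg_bernstein: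
  fixes p :: "'a::real_normed_vector \<Rightarrow> complex"
  assumes p: "poly_deg d p" and s: "s > 0"
    and bound: "\<And>y. y \<in> cball x s \<Longrightarrow> norm (p y) \<le> M"
  shows "norm (frechet_derivative p (at x) v) \<le> 2 * (real d + 1)\<^sup>2 * M / s * norm v"
proof (cases "v = 0")
  case True
  have "linear (frechet_derivative p (at x))"
    by (rule linear_frechet_derivative) (rule poly_deg_differentiable[OF p])
  then show ?thesis
    using True by (simp add: linear_0)
next
  case False
  \<comment> \<open>Scaled to length \<open>s\<close>, so that parameters in \<open>[-1, 1]\<close>
    stay inside \<open>cball x s\<close>.\<close>
  define u where "u = (s / norm v) *\<^sub>R v"
  obtain q where q: "degree q \<le> d" "\<And>t. p (x + t *\<^sub>R u) = poly q (of_real t)"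
    using poly_deg_along_line[OF p, of x u] by auto
  have D: "(p has_derivative frechet_derivative p (at x)) (at x)"
    using poly_deg_differentiable[OF p] frechet_derivative_works by blast
  interpret D: bounded_linear "frechet_derivative p (at x)"
    using D by (rule has_derivative_bounded_linear)
  have "norm (poly (pderiv q) 0) \<le> 2 * (real d + 1)\<^sup>2 * M"
  proof (rule bernstein_at_zero[OF q(1)])
    fix t :: real assume t: "\<bar>t\<bar> \<le> 1"
    have "norm (t *\<^sub>R u) \<le> s"
      using t s False mult_left_le_one_le[of s "\<bar>t\<bar>"] by (simp add: u_def abs_mult)
    then show "norm (poly q (of_real t)) \<le> M"
      unfolding q(2)[symmetric] by (intro bound) (auto simp: dist_norm)
  qed
  moreover have "poly (pderiv q) 0 = frechet_derivative p (at x) u"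
  proof -
    have "((\<lambda>t. x + t *\<^sub>R u) has_derivative (\<lambda>t. t *\<^sub>R u)) (at (0::real))"
      by (auto intro!: derivative_eq_intros)
    from has_derivative_compose[OF this, of p "frechet_derivative p (at x)"]
    have "((\<lambda>t. p (x + t *\<^sub>R u)) has_vector_derivative frechet_derivative p (at x) u) (at 0)"
      unfolding has_vector_derivative_def using D by (simp add: D.scaleR)
    moreover have "((\<lambda>t. poly q (of_real t)) has_vector_derivative poly (pderiv q) 0) (at (0::real))"
      by (rule has_vector_derivative_real_field) (simp add: poly_DERIV)
    ultimately show ?thesis
      unfolding q(2) by (rule vector_derivative_unique_at[rotated])
  qed
  ultimately have "s / norm v * norm (frechet_derivative p (at x) v) \<le> 2 * (real d + 1)\<^sup>2 * M"
    using s by (simp add: u_def D.scaleR)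
  then show ?thesis
    using s False by (simp add: field_simps)
qed

section \<open>Smoothness of series of polynomials\<close>

text \<open>At points of an open set, derivatives depend only on the values in that set. This allows
  the derivative of a series to be replaced by the series of derivatives, an identity known only
  inside a ball.\<close>

lemma C_k_on_cong:
  assumes "open U" "\<And>x. x \<in> U \<Longrightarrow> f x = g x" "C_k_on n U f"
  shows "C_k_on n U g"
  using assms(2,3)
proof (induction n arbitrary: f g)
  case 0
  then show ?case
    using continuous_on_cong[OF refl, of U f g] by simp
next
  case (Suc n)
  have "g differentiable (at x) \<and> frechet_derivative f (at x) = frechet_derivative g (at x)"
    if "x \<in> U" for x
  proof -
    have "(f has_derivative frechet_derivative f (at x)) (at x)"
      using Suc.prems(2) that frechet_derivative_works by auto
    then have "(g has_derivative frechet_derivative f (at x)) (at x)"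
      using has_derivative_transform_within_open[OF _ \<open>open U\<close> that] Suc.prems(1) by blast
    then show ?thesis
      using differentiableI frechet_derivative_at by blast
  qed
  then show ?case
    using Suc.prems(2) Suc.IH[of "\<lambda>x. frechet_derivative f (at x) v"
        "\<lambda>x. frechet_derivative g (at x) v" for v] by auto
qed

text \<open>By Bernstein's inequality the derivatives of the terms satisfy, on a smaller ball, the same
  kind of bound as the terms, so termwise differentiation can be iterated.\<close>

lemma C_k_on_suminf_poly_deg:
  fixes u :: "nat \<Rightarrow> 'a::euclidean_space \<Rightarrow> complex"
  assumes "\<And>N. poly_deg (d N) (u N)"
    and "\<And>N x. x \<in> cball a R \<Longrightarrow> norm (u N x) \<le> M N"
    and "\<And>m. summable (\<lambda>N. M N * (real (d N) + 1) ^ m)"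
    and "0 < r" "r < R"
  shows "C_k_on n (ball a r) (\<lambda>x. \<Sum>N. u N x)"
  using assms
proof (induction n arbitrary: u M R r)
  case 0
  have "uniform_limit (cball a R) (\<lambda>n x. \<Sum>i<n. u i x) (\<lambda>x. \<Sum>i. u i x) sequentially"
    using "0.prems"(2) "0.prems"(3)[of 0] by (intro Weierstrass_m_test) auto
  moreover have "continuous_on (cball a R) (\<lambda>x. \<Sum>i<n. u i x)" for n
    using poly_deg_continuous_on[OF "0.prems"(1)] by (intro continuous_on_sum) auto
  ultimately have "continuous_on (cball a R) (\<lambda>x. \<Sum>i. u i x)"
    by (intro uniform_limit_theorem[where F = sequentially]) (auto intro: always_eventually)
  then show ?case
    using "0.prems"(4,5) by (auto intro: continuous_on_subset)
next
  case (Suc n)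
  \<comment> \<open>An intermediate radius: Bernstein's inequality uses the margin
    \<open>R - r'\<close>, and the induction hypothesis for the derivatives uses
    \<open>r < r'\<close>.\<close>
  define r' where "r' = (r + R) / 2"
  have r': "0 < r'" "r < r'" "r' < R"
    using Suc.prems(4,5) by (auto simp: r'_def)
  define B where "B N = 2 * (real (d N) + 1)\<^sup>2 * M N / (R - r')" for N
  define D where "D N x v = frechet_derivative (u N) (at x) v" for N x v
  have D_bound: "norm (D N x v) \<le> B N * norm v" if "x \<in> cball a r'" for N x v
    unfolding D_def B_def
  proof (rule poly_deg_bernstein[OF Suc.prems(1)])
    show "norm (u N y) \<le> M N" if "y \<in> cball x (R - r')" for y
    proof (rule Suc.prems(2))
      show "y \<in> cball a R"
        using that \<open>x \<in> cball a r'\<close> dist_triangle[of a y x] by auto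
    qed
  qed (use r' in auto)
  \<comment> \<open>Each differentiation costs a factor \<open>(d N + 1) ^ 2\<close>, absorbed by
    raising the exponent from \<open>m\<close> to \<open>m + 2\<close>; hence summability is assumed
    for all exponents.\<close>
  have B_summable: "summable (\<lambda>N. B N * (real (d N) + 1) ^ m)" for m
  proof -
    have "B N * (real (d N) + 1) ^ m = 2 / (R - r') * (M N * (real (d N) + 1) ^ (m + 2))" for N
      by (simp add: B_def power_add power2_eq_square)
    then show ?thesis
      using summable_mult[OF Suc.prems(3)[of "m + 2"], of "2 / (R - r')"] by simp
  qed
  have B: "summable B"
    using B_summable[of 0] by simp
  have D_summable: "summable (\<lambda>N. D N x v)" if "x \<in> cball a r'" for x v
    using D_bound[OF that] by (intro summable_comparison_test'[OF summable_mult2[OF B]])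
  have M: "summable M"
    using Suc.prems(3)[of 0] by simp
  have "\<exists>g. \<forall>x\<in>ball a r'. (\<lambda>N. u N x) sums g x \<and>
      (g has_derivative (\<lambda>v. \<Sum>N. D N x v)) (at x within ball a r')"
  proof (rule has_derivative_series)
    show "(u N has_derivative D N x) (at x within ball a r')" for N x
      unfolding D_def using poly_deg_differentiable[OF Suc.prems(1)] frechet_derivative_works
        has_derivative_at_withinI by blast
    \<comment> \<open>The tails of \<open>B\<close> bound the remainder uniformly in
      \<open>x\<close>.\<close>
    show "\<forall>\<^sub>F n in sequentially. \<forall>x\<in>ball a r'. \<forall>h.
        norm ((\<Sum>i<n. D i x h) - (\<Sum>N. D N x h)) \<le> e * norm h" if "e > 0" for e
    proof -
      obtain N0 where N0: "\<And>n. n \<ge> N0 \<Longrightarrow> norm (\<Sum>i. B (i + n)) < e"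
        using suminf_exist_split[OF \<open>e > 0\<close> B] by blast
      have "norm ((\<Sum>i<n. D i x h) - (\<Sum>N. D N x h)) \<le> e * norm h"
        if "n \<ge> N0" "x \<in> ball a r'" for n x h
      proof -
        have x: "x \<in> cball a r'" using that by auto
        have *: "summable (\<lambda>i. B (i + n) * norm h)"
          using B by (intro summable_mult2) (simp add: summable_iff_shift)
        have "norm ((\<Sum>i<n. D i x h) - (\<Sum>N. D N x h)) = norm (\<Sum>i. D (i + n) x h)"
          unfolding suminf_split_initial_segment[OF D_summable[OF x], of h n] by simp
        also have "\<dots> \<le> (\<Sum>i. B (i + n) * norm h)"
          by (rule norm_suminf_le[OF _ *]) (rule D_bound[OF x])
        also have "\<dots> = (\<Sum>i. B (i + n)) * norm h"
          using B by (intro suminf_mult2[symmetric]) (simp add: summable_iff_shift)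
        also have "\<dots> \<le> e * norm h"
          using N0[OF that(1)] by (intro mult_right_mono) auto
        finally show ?thesis .
      qed
      then show ?thesis
        by (intro eventually_sequentiallyI[of N0]) auto
    qed
    show "(\<lambda>N. u N a) sums (\<Sum>N. u N a)"
      using Suc.prems(2)[of a] Suc.prems(4,5)
      by (intro summable_sums summable_comparison_test'[OF M]) auto
  qed (use r' in auto)
  then obtain g where g: "\<And>x. x \<in> ball a r' \<Longrightarrow> (\<lambda>N. u N x) sums g x"
    "\<And>x. x \<in> ball a r' \<Longrightarrow> (g has_derivative (\<lambda>v. \<Sum>N. D N x v)) (at x)"
    by (metis at_within_open open_ball)
  have deriv: "((\<lambda>x. \<Sum>N. u N x) has_derivative (\<lambda>v. \<Sum>N. D N x v)) (at x)" if "x \<in> ball a r'" for x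
    by (rule has_derivative_transform_within_open[OF g(2)[OF that] _ that])
      (use sums_unique[OF g(1)] in auto)
  have sub: "ball a r \<subseteq> ball a r'" using r' by auto
  show ?case
    unfolding C_k_on.simps
  proof (intro conjI ballI allI)
    show "(\<lambda>x. \<Sum>N. u N x) differentiable at x" if "x \<in> ball a r" for x
      using deriv[of x] sub that differentiableI by blast
    fix v
    have "C_k_on n (ball a r) (\<lambda>x. \<Sum>N. D N x v)"
    proof (rule Suc.IH[where M = "\<lambda>N. B N * norm v" and R = r'])
      show "poly_deg (d N) (\<lambda>x. D N x v)" for N
        unfolding D_def by (rule poly_deg_frechet_derivative[OF Suc.prems(1)])
      show "summable (\<lambda>N. B N * norm v * (real (d N) + 1) ^ m)" for m
        using summable_mult[OF B_summable, of "norm v" m] by (simp add: mult_ac)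
    qed (use Suc.prems r' D_bound in auto)
    moreover have "(\<Sum>N. D N x v) = frechet_derivative (\<lambda>x. \<Sum>N. u N x) (at x) v"
      if "x \<in> ball a r" for x
      using frechet_derivative_at[OF deriv[of x]] sub that by (metis subsetD)
    ultimately show "C_k_on n (ball a r) (\<lambda>x. frechet_derivative (\<lambda>x. \<Sum>N. u N x) (at x) v)"
      by (rule C_k_on_cong[OF open_ball, rotated])
  qed
qed

section \<open>Homogeneous polynomials\<close>

lemma poly_deg_power: "poly_deg d f \<Longrightarrow> poly_deg (n * d) (\<lambda>x. f x ^ n)"
  by (induction n) (auto intro: poly_deg.const poly_deg.mult)

lemma poly_deg_prod:
  assumes "finite A" "\<And>i. i \<in> A \<Longrightarrow> poly_deg (e i) (f i)"
  shows "poly_deg (\<Sum>i\<in>A. e i) (\<lambda>x. \<Prod>i\<in>A. f i x)"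
  using assms by (induction rule: finite_induct) (auto intro: poly_deg.const poly_deg.mult)

lemma poly_deg_sum:
  assumes "finite A" "\<And>i. i \<in> A \<Longrightarrow> poly_deg d (f i)"
  shows "poly_deg d (\<lambda>x. \<Sum>i\<in>A. f i x)"
  using assms
  by (induction rule: finite_induct) (auto intro: poly_deg.const poly_deg.add poly_deg.mono)

lemma poly_deg_compose_linear:
  assumes "poly_deg d f" "bounded_linear h"
  shows "poly_deg d (\<lambda>x. f (h x))"
  using assms
  by (induction rule: poly_deg.induct)
    (auto intro: poly_deg.const poly_deg.mult poly_deg.add poly_deg.mono poly_deg.linear[simplified]
      bounded_linear_compose)

lemma poly_deg_monomial_fun: "poly_deg (\<Sum>i\<in>UNIV. \<alpha> i) (monomial_fun \<alpha>)"
proof -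
  have "poly_deg (\<alpha> i * 1) (\<lambda>x. of_real (x $ i) ^ \<alpha> i)" for i
    by (intro poly_deg_power poly_deg.linear bounded_linear_compose[OF bounded_linear_of_real]
        bounded_linear_vec_nth)
  then show ?thesis
    unfolding monomial_fun_def by (intro poly_deg_prod) auto
qed

lemma homogeneous_polys_poly_deg:
  assumes "p \<in> homogeneous_polys k"
  shows "poly_deg k p"
proof -
  have "homogeneous_polys k \<subseteq> Collect (poly_deg k)"
    unfolding homogeneous_polys_def
  proof (rule cfun.span_minimal)
    show "{monomial_fun \<alpha> |\<alpha>. sum \<alpha> UNIV = k} \<subseteq> Collect (poly_deg k)"
      using poly_deg_monomial_fun by auto
    show "cfun.subspace (Collect (poly_deg k))"
    proof (rule cfun.subspaceI)
      show "cscale c f \<in> Collect (poly_deg k)" if "f \<in> Collect (poly_deg k)" for c f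
        using poly_deg.mult[OF poly_deg.const[of c], of k f] that by (simp add: cscale_def)
    qed (auto simp: plus_fun_def zero_fun_def intro: poly_deg.add poly_deg.const poly_deg.mono)
  qed
  then show ?thesis using assms by auto
qed

text \<open>For fixed \<open>t\<close> and \<open>x\<close> the identity is linear in
  \<open>p\<close>, so it passes from monomials to their span. Negative \<open>t\<close> is
  included; \<open>t = -1\<close> gives the parity of \<open>p\<close>.\<close>

lemma homogeneous_polys_scaleR:
  assumes "p \<in> homogeneous_polys k"
  shows "p (t *\<^sub>R x) = of_real t ^ k * p x"
proof -
  let ?S = "{p. p (t *\<^sub>R x) = of_real t ^ k * p x}"
  have "homogeneous_polys k \<subseteq> ?S"
    unfolding homogeneous_polys_def
  proof (rule cfun.span_minimal)
    show "{monomial_fun \<alpha> |\<alpha>. sum \<alpha> UNIV = k} \<subseteq> ?S"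
      by (auto simp: monomial_fun_def power_mult_distrib prod.distrib power_sum)
    show "cfun.subspace ?S"
      by (rule cfun.subspaceI) (auto simp: cscale_def plus_fun_def zero_fun_def algebra_simps)
  qed
  then show ?thesis using assms by auto
qed

lemma homogeneous_polys_norm_le:
  fixes p :: "real^'n::finite \<Rightarrow> complex"
  assumes p: "p \<in> homogeneous_polys k"
    and bound: "\<And>\<theta>. \<theta> \<in> sphere 0 1 \<Longrightarrow> norm (p \<theta>) \<le> M"
  shows "norm (p x) \<le> M * norm x ^ k"
proof -
  obtain \<theta>0 :: "real^'n" where "norm \<theta>0 = 1"
    using vector_choose_size[of 1] by auto
  \<comment> \<open>At \<open>x = 0\<close> any unit vector serves as direction; this also covers
    \<open>k = 0\<close>, where \<open>norm x ^ k = 1\<close>.\<close>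
  define \<omega> where "\<omega> = (if x = 0 then \<theta>0 else sgn x)"
  have "\<omega> \<in> sphere 0 1" "x = norm x *\<^sub>R \<omega>"
    using \<open>norm \<theta>0 = 1\<close> by (auto simp: \<omega>_def norm_sgn sgn_div_norm)
  then have "norm (p x) = norm x ^ k * norm (p \<omega>)"
    using homogeneous_polys_scaleR[OF p, of "norm x" \<omega>] by (simp add: norm_mult norm_power)
  then show ?thesis
    using bound[OF \<open>\<omega> \<in> sphere 0 1\<close>] by (simp add: mult.commute mult_right_mono)
qed

text \<open>Harmonic polynomials lie in the span of the monomials of degree \<open>k\<close>, whose
  exponents are all in \<open>{..k}\<close>. A crude count is enough: geometric decay will dominate
  any power of \<open>k\<close>.\<close>

lemma harmonic_dim_le: "harmonic_dim TYPE('n::finite) k \<le> (k + 1) ^ CARD('n)"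
proof -
  let ?A = "{\<alpha> :: 'n \<Rightarrow> nat. sum \<alpha> UNIV = k}"
  have sub: "?A \<subseteq> (UNIV \<rightarrow>\<^sub>E {..k})"
    by (auto simp: member_le_sum)
  have fin: "finite (UNIV \<rightarrow>\<^sub>E {..k} :: ('n \<Rightarrow> nat) set)"
    by (intro finite_PiE) auto
  have "finite ?A" using sub fin by (rule finite_subset)
  have eq: "{monomial_fun \<alpha> |\<alpha> :: 'n \<Rightarrow> nat. sum \<alpha> UNIV = k} = monomial_fun ` ?A" by auto
  have "harmonic_dim TYPE('n) k \<le> card (monomial_fun ` ?A)"
    unfolding harmonic_dim_def using \<open>finite ?A\<close>
    by (intro cfun.dim_le_card) (auto simp: harmonic_polys_def homogeneous_polys_def eq)
  also have "\<dots> \<le> card ?A"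
    using \<open>finite ?A\<close> by (rule card_image_le)
  also have "\<dots> \<le> card (UNIV \<rightarrow>\<^sub>E {..k} :: ('n \<Rightarrow> nat) set)"
    by (rule card_mono[OF fin sub])
  also have "\<dots> = (k + 1) ^ CARD('n)"
    by (simp add: card_PiE)
  finally show ?thesis .
qed

text \<open>With \<open>M\<close> the maximum on the sphere, homogeneity gives the bound
  \<open>3 * M\<close> within distance \<open>1 / (k + 1)\<close> of the unit ball. Bernstein's
  inequality turns this into the Lipschitz constant \<open>6 * (k + 1) ^ 3 * M\<close>, so over the
  given distance \<open>p\<close> changes by at most \<open>M / 2\<close>.\<close>

lemma homogeneous_polys_half_max_near:
  fixes p :: "real^'n::finite \<Rightarrow> complex"
  assumes p: "p \<in> homogeneous_polys k"
    and \<theta>0: "\<theta>0 \<in> sphere 0 1" "\<And>\<theta>. \<theta> \<in> sphere 0 1 \<Longrightarrow> norm (p \<theta>) \<le> norm (p \<theta>0)"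
    and \<theta>: "\<theta> \<in> sphere 0 1" "dist \<theta>0 \<theta> \<le> 1 / (12 * (real k + 1) ^ 3)"
  shows "norm (p \<theta>0) / 2 \<le> norm (p \<theta>)"
proof -
  define M where "M = norm (p \<theta>0)"
  have le: "norm (p x) \<le> M * norm x ^ k" for x
    by (rule homogeneous_polys_norm_le[OF p]) (simp add: M_def \<theta>0(2))
  have three: "(1 + 1 / (real k + 1)) ^ k \<le> 3"
  proof -
    have "(1 + 1 / (real k + 1)) ^ k \<le> exp (1 / (real k + 1)) ^ k"
      by (intro power_mono) (auto simp: exp_ge_add_one_self)
    also have "\<dots> = exp (real k / (real k + 1))"
      by (simp flip: exp_of_nat_mult)
    also have "\<dots> \<le> exp 1" by simp
    also have "\<dots> \<le> 3" by (rule exp_le)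
    finally show ?thesis .
  qed
  have near: "norm (p y) \<le> 3 * M" if "norm x \<le> 1" "y \<in> cball x (1 / (real k + 1))" for x y
  proof -
    have "norm y \<le> 1 + 1 / (real k + 1)"
      using that norm_triangle_ineq2[of y x] by (auto simp: dist_norm norm_minus_commute)
    then have "norm y ^ k \<le> 3"
      using three by (meson norm_ge_zero order.trans power_mono)
    then have "M * norm y ^ k \<le> M * 3"
      by (intro mult_left_mono) (auto simp: M_def)
    then show ?thesis
      using le[of y] by simp
  qed
  \<comment> \<open>The mean value estimate needs a convex set, so it runs over the closed unit ball
    rather than the sphere.\<close>
  have "norm (p \<theta>0 - p \<theta>) \<le> (6 * (real k + 1) ^ 3 * M) * norm (\<theta>0 - \<theta>)"
  proof (rule differentiable_bound)
    show "convex (cball (0::real^'n) 1)" by simp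
    fix x :: "real^'n" assume x: "x \<in> cball 0 1"
    show "(p has_derivative frechet_derivative p (at x)) (at x within cball 0 1)"
      using poly_deg_differentiable[OF homogeneous_polys_poly_deg[OF p]] frechet_derivative_works
        has_derivative_at_withinI by blast
    show "onorm (frechet_derivative p (at x)) \<le> 6 * (real k + 1) ^ 3 * M"
    proof (rule onorm_bound)
      fix v
      have "norm (frechet_derivative p (at x) v) \<le>
          2 * (real k + 1)\<^sup>2 * (3 * M) / (1 / (real k + 1)) * norm v"
        by (rule poly_deg_bernstein[OF homogeneous_polys_poly_deg[OF p]]) (use near x in auto)
      then show "norm (frechet_derivative p (at x) v) \<le> 6 * (real k + 1) ^ 3 * M * norm v"
        by (simp add: power2_eq_square power3_eq_cube algebra_simps)
    qed (simp add: M_def)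
  qed (use \<theta>0(1) \<theta>(1) in auto)
  also have "\<dots> \<le> (6 * (real k + 1) ^ 3 * M) * (1 / (12 * (real k + 1) ^ 3))"
    using \<theta>(2) by (intro mult_left_mono) (auto simp: dist_norm M_def)
  also have "\<dots> = M / 2"
    by (simp add: field_simps)
  finally show ?thesis
    using norm_triangle_ineq2[of "p \<theta>0" "p \<theta>"] by (simp add: M_def)
qed

section \<open>Spherical caps and the sup bound\<close>

text \<open>Points in the same cell of the grid of mesh \<open>1 / m\<close> differ by at most
  \<open>1 / m\<close> in each coordinate, hence by \<open>CARD('n) / m\<close> in norm.
  \<open>P\<close> takes one point of the sphere from every cell that meets it; each coordinate of a
  cell index is one of \<open>2 * m + 1\<close> integers.\<close>

lemma sphere_covering:
  fixes m :: nat
  assumes "m > 0"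
  obtains P :: "(real^'n::finite) set" where "finite P" "card P \<le> (2 * m + 1) ^ CARD('n)"
    "P \<subseteq> sphere 0 1" "sphere 0 1 \<subseteq> (\<Union>x\<in>P. cball x (real CARD('n) / real m))"
proof -
  define g where "g x = (\<lambda>i::'n. \<lfloor>real m * x $ i\<rfloor>)" for x :: "real^'n"
  define h where "h = inv_into (sphere 0 1) g"
  define P where "P = h ` g ` sphere 0 1"
  have sub: "g ` sphere 0 1 \<subseteq> (UNIV \<rightarrow>\<^sub>E {-int m..int m})"
  proof -
    have "- int m \<le> g x i \<and> g x i \<le> int m" if "x \<in> sphere 0 1" for x i
    proof -
      have "\<bar>x $ i\<bar> \<le> 1" using component_le_norm_cart[of x i] that by simp
      then have "real m * x $ i \<le> real m" "- real m \<le> real m * x $ i"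
        using mult_left_mono[of "x $ i" 1 "real m"] mult_left_mono[of "-1" "x $ i" "real m"] by auto
      then show ?thesis
        unfolding g_def by (simp add: le_floor_iff floor_le_iff)
    qed
    then show ?thesis by auto
  qed
  have fin: "finite (UNIV \<rightarrow>\<^sub>E {-int m..int m} :: ('n \<Rightarrow> int) set)"
    by (intro finite_PiE) auto
  have "finite (g ` sphere 0 1)" using sub fin by (rule finite_subset)
  then have "finite P" by (simp add: P_def)
  have "card P \<le> (2 * m + 1) ^ CARD('n)"
  proof -
    have "card P \<le> card (g ` sphere 0 1)"
      unfolding P_def by (rule card_image_le) (rule \<open>finite (g ` sphere 0 1)\<close>)
    also have "\<dots> \<le> card (UNIV \<rightarrow>\<^sub>E {-int m..int m} :: ('n \<Rightarrow> int) set)"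
      by (rule card_mono[OF fin sub])
    also have "\<dots> = (2 * m + 1) ^ CARD('n)"
      by (simp add: card_PiE nat_add_distrib nat_mult_distrib)
    finally show ?thesis .
  qed
  have "P \<subseteq> sphere 0 1"
    unfolding P_def h_def using inv_into_into[of _ g "sphere 0 1"] by blast
  have "\<exists>y\<in>P. x \<in> cball y (real CARD('n) / real m)" if x: "x \<in> sphere 0 1" for x
  proof -
    define y where "y = h (g x)"
    have gy: "g y = g x"
      unfolding y_def h_def using x by (intro f_inv_into_f) auto
    have "\<bar>(y - x) $ i\<bar> \<le> 1 / real m" for i
    proof -
      have "\<lfloor>real m * y $ i\<rfloor> = \<lfloor>real m * x $ i\<rfloor>"
        using gy by (auto simp: g_def fun_eq_iff)
      then have "\<bar>real m * y $ i - real m * x $ i\<bar> \<le> 1"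
        by linarith
      then have "real m * \<bar>y $ i - x $ i\<bar> \<le> 1"
        by (metis abs_mult abs_of_nat right_diff_distrib)
      then show ?thesis
        using assms by (simp add: field_simps)
    qed
    then have "norm (y - x) \<le> (\<Sum>i\<in>(UNIV::'n set). 1 / real m)"
      by (intro order.trans[OF norm_le_l1_cart] sum_mono)
    then have "x \<in> cball y (real CARD('n) / real m)"
      by (simp add: dist_norm)
    moreover have "y \<in> P" using x by (auto simp: P_def y_def)
    ultimately show ?thesis by blast
  qed
  then have "sphere 0 1 \<subseteq> (\<Union>x\<in>P. cball x (real CARD('n) / real m))"
    unfolding subset_iff UN_iff by blast
  show ?thesis
    by (rule that) fact+
qed

context
  fixes \<sigma> :: "(real^'n::finite) measure"
  assumes card: "CARD('n) \<ge> 2" and rot: "rotation_invariant_sphere_measure \<sigma>"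
begin

lemma sets_sphere_measure: "sets \<sigma> = sets (restrict_space borel (sphere 0 1))"
  and space_sphere_measure: "space \<sigma> = sphere 0 1"
  and finite_sphere_measure: "finite_measure \<sigma>"
  using rot sets_eq_imp_space_eq[of \<sigma> "restrict_space borel (sphere 0 1)"]
  by (auto simp: rotation_invariant_sphere_measure_def space_restrict_space)

interpretation finite_measure \<sigma>
  by (rule finite_sphere_measure)

lemma measure_sphere_pos: "measure \<sigma> (sphere 0 1) > 0"
  using rot measure_nonneg[of \<sigma> "space \<sigma>"]
  by (simp add: rotation_invariant_sphere_measure_def emeasure_eq_measure space_sphere_measure
      zero_less_measure_iff)

lemma sphere_cap_in_sets: "sphere 0 1 \<inter> cball \<theta> \<rho> \<in> sets \<sigma>"
  by (simp add: sets_sphere_measure sets_restrict_space image_iff) (metis borel_closed closed_cball)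

lemma measure_sphere_cap_eq:
  assumes "\<theta> \<in> sphere 0 1" "\<theta>' \<in> sphere 0 1"
  shows "measure \<sigma> (sphere 0 1 \<inter> cball \<theta> \<rho>) = measure \<sigma> (sphere 0 1 \<inter> cball \<theta>' \<rho>)"
proof -
  \<comment> \<open>Here \<open>CARD('n) \<ge> 2\<close> enters: in dimension one the only rotation
    is the identity, which cannot exchange the two points of the sphere.\<close>
  obtain T where T: "orthogonal_transformation T" "det (matrix T) = 1" "T \<theta> = \<theta>'"
    using rotation_exists[OF card, of \<theta> \<theta>'] assms by auto
  have T_norm: "norm (T x) = norm x" for x
    using T(1) by (rule orthogonal_transformation_norm)
  have T_dist: "dist (T x) (T y) = dist x y" for x y
    using T(1) orthogonal_transformation_isometry by blast
  have "linear T" using T(1) orthogonal_transformation by blast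
  then have "T \<in> borel_measurable borel"
    by (intro borel_measurable_continuous_onI linear_continuous_on linear_conv_bounded_linear[THEN iffD1])
  then have "T \<in> restrict_space borel (sphere 0 1) \<rightarrow>\<^sub>M restrict_space borel (sphere 0 1)"
    by (intro measurable_restrict_space3) (auto simp: T_norm)
  then have meas: "T \<in> \<sigma> \<rightarrow>\<^sub>M \<sigma>"
    using measurable_cong_sets[OF sets_sphere_measure sets_sphere_measure] by simp
  have "measure \<sigma> (sphere 0 1 \<inter> cball \<theta>' \<rho>) = measure (distr \<sigma> \<sigma> T) (sphere 0 1 \<inter> cball \<theta>' \<rho>)"
    using rot T(1,2) by (simp add: rotation_invariant_sphere_measure_def)
  also have "\<dots> = measure \<sigma> (T -` (sphere 0 1 \<inter> cball \<theta>' \<rho>) \<inter> space \<sigma>)"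
    by (rule measure_distr[OF meas sphere_cap_in_sets])
  also have "T -` (sphere 0 1 \<inter> cball \<theta>' \<rho>) \<inter> space \<sigma> = sphere 0 1 \<inter> cball \<theta> \<rho>"
    using T_dist[of \<theta>] by (auto simp: space_sphere_measure T_norm T(3))
  finally show ?thesis by simp
qed

text \<open>A lower bound for the mass of one cap: the covering caps have the same mass as the one
  around \<open>\<theta>\<close>, so subadditivity applies.\<close>

lemma measure_sphere_le_cap:
  fixes m :: nat
  assumes "m > 0" "\<theta> \<in> sphere 0 1"
  shows "measure \<sigma> (sphere 0 1) \<le>
    real ((2 * m + 1) ^ CARD('n)) * measure \<sigma> (sphere 0 1 \<inter> cball \<theta> (real CARD('n) / real m))"
proof -
  let ?\<rho> = "real CARD('n) / real m"
  obtain P :: "(real^'n) set" where P: "finite P" "card P \<le> (2 * m + 1) ^ CARD('n)"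
    "P \<subseteq> sphere 0 1" "sphere 0 1 \<subseteq> (\<Union>x\<in>P. cball x ?\<rho>)"
    by (rule sphere_covering[OF assms(1)])
  have "sphere 0 1 = (\<Union>x\<in>P. sphere 0 1 \<inter> cball x ?\<rho>)"
    using P(4) by blast
  then have "measure \<sigma> (sphere 0 1) \<le> (\<Sum>x\<in>P. measure \<sigma> (sphere 0 1 \<inter> cball x ?\<rho>))"
    using finite_measure_subadditive_finite[OF P(1), of "\<lambda>x. sphere 0 1 \<inter> cball x ?\<rho>"]
      sphere_cap_in_sets by auto
  also have "\<dots> = (\<Sum>x\<in>P. measure \<sigma> (sphere 0 1 \<inter> cball \<theta> ?\<rho>))"
    using P(3) assms(2) by (intro sum.cong measure_sphere_cap_eq) auto
  also have "\<dots> \<le> real ((2 * m + 1) ^ CARD('n)) * measure \<sigma> (sphere 0 1 \<inter> cball \<theta> ?\<rho>)"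
    using P(2) by (simp del: of_nat_power add: mult_right_mono)
  finally show ?thesis .
qed

text \<open>A homogeneous polynomial of degree \<open>k\<close> keeps at least half of its maximal modulus on a cap
  whose radius is polynomial in \<open>1 / k\<close>, and by rotation invariance polynomially many caps of this
  size, all of the same mass, cover the sphere.\<close>

lemma homogeneous_polys_sup_bound:
  obtains K where "K \<ge> 0"
    "\<And>k p \<theta>. p \<in> homogeneous_polys k \<Longrightarrow> (LINT \<theta>|\<sigma>. p \<theta> * cnj (p \<theta>)) = 1 \<Longrightarrow>
      \<theta> \<in> sphere 0 1 \<Longrightarrow> norm (p \<theta>) \<le> K * (real k + 1) ^ (3 * CARD('n))"
proof
  define S where "S = measure \<sigma> (sphere 0 1)"
  \<comment> \<open>The 4 comes from the half maximum in \<open>(M / 2)\<^sup>2\<close>, the 25 from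
    \<open>2 * m + 1 \<le> 25 * CARD('n) * (k + 1) ^ 3\<close>, and the summand 1 from
    \<open>M \<le> 1 + M\<^sup>2\<close>, which avoids a square root.\<close>
  define K where "K = 1 + 4 * (25 * real CARD('n)) ^ CARD('n) / S"
  have S: "S > 0" unfolding S_def by (rule measure_sphere_pos)
  show "K \<ge> 0" using S by (simp add: K_def)
  fix k :: nat and p :: "real^'n \<Rightarrow> complex" and \<theta> :: "real^'n"
  assume p: "p \<in> homogeneous_polys k" and int: "(LINT \<theta>|\<sigma>. p \<theta> * cnj (p \<theta>)) = 1"
    and \<theta>: "\<theta> \<in> sphere 0 1"
  have cont: "continuous_on A p" for A
    by (rule poly_deg_continuous_on[OF homogeneous_polys_poly_deg[OF p]])
  obtain \<theta>0 where \<theta>0: "\<theta>0 \<in> sphere 0 1" "\<And>\<theta>. \<theta> \<in> sphere 0 1 \<Longrightarrow> norm (p \<theta>) \<le> norm (p \<theta>0)"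
    using continuous_attains_sup[of "sphere 0 1" "\<lambda>x. norm (p x)"] \<theta>
    by (metis compact_sphere cont continuous_on_norm empty_iff)
  define M where "M = norm (p \<theta>0)"
  \<comment> \<open>Chosen so that the covering radius \<open>CARD('n) / m\<close> is exactly the
    distance on which half the maximum persists.\<close>
  define m where "m = 12 * CARD('n) * (k + 1) ^ 3"
  define C where "C = sphere 0 1 \<inter> cball \<theta>0 (real CARD('n) / real m)"
  have "m > 0" by (simp add: m_def)
  have \<rho>: "real CARD('n) / real m = 1 / (12 * (real k + 1) ^ 3)"
    by (simp add: m_def divide_simps add.commute)
  have C: "C \<in> sets \<sigma>" unfolding C_def by (rule sphere_cap_in_sets)
  have half: "M / 2 \<le> norm (p \<omega>)" if "\<omega> \<in> C" for \<omega>
    unfolding M_def using that \<theta>0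
    by (intro homogeneous_polys_half_max_near[OF p]) (auto simp: C_def \<rho>)
  have meas: "p \<in> borel_measurable \<sigma>"
    using measurable_cong_sets[OF sets_sphere_measure refl]
      borel_measurable_continuous_on_restrict[OF cont] by blast
  have integrable: "integrable \<sigma> (\<lambda>\<theta>. (norm (p \<theta>))\<^sup>2)"
    using \<theta>0(2) meas
    by (intro integrable_const_bound[where B = "M\<^sup>2"] AE_I2)
      (auto simp: space_sphere_measure M_def intro!: power_mono)
  have "(\<lambda>\<theta>. p \<theta> * cnj (p \<theta>)) = (\<lambda>\<theta>. of_real ((norm (p \<theta>))\<^sup>2))"
    by (simp add: complex_norm_square[symmetric])
  then have int1: "(LINT \<theta>|\<sigma>. (norm (p \<theta>))\<^sup>2) = 1"
    using int by (simp del: of_real_power)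
  \<comment> \<open>The normalised integral of the squared modulus dominates its part over the cap,
    where the modulus is at least \<open>M / 2\<close>.\<close>
  have "(LINT \<theta>|\<sigma>. (M / 2)\<^sup>2 * indicator C \<theta>) \<le> (LINT \<theta>|\<sigma>. (norm (p \<theta>))\<^sup>2)"
  proof (rule integral_mono)
    show "integrable \<sigma> (\<lambda>\<theta>. (M / 2)\<^sup>2 * indicator C \<theta>)"
      using C by (intro integrable_mult_right) (auto simp: emeasure_eq_measure)
    show "(M / 2)\<^sup>2 * indicator C \<omega> \<le> (norm (p \<omega>))\<^sup>2" for \<omega>
      using half[of \<omega>] by (auto simp: indicator_def M_def intro!: power_mono)
  qed (rule integrable)
  then have le1: "(M / 2)\<^sup>2 * measure \<sigma> C \<le> 1"
    using C int1 by (simp add: emeasure_eq_measure sets.Int_space_eq2)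
  have "S \<le> real ((2 * m + 1) ^ CARD('n)) * measure \<sigma> C"
    unfolding S_def C_def by (rule measure_sphere_le_cap[OF \<open>m > 0\<close> \<theta>0(1)])
  then have "(M / 2)\<^sup>2 * S \<le> (M / 2)\<^sup>2 * (real ((2 * m + 1) ^ CARD('n)) * measure \<sigma> C)"
    by (intro mult_left_mono) auto
  also have "\<dots> = real ((2 * m + 1) ^ CARD('n)) * ((M / 2)\<^sup>2 * measure \<sigma> C)"
    by (simp add: mult_ac)
  also have "\<dots> \<le> real ((2 * m + 1) ^ CARD('n))"
    using mult_left_mono[OF le1, of "real ((2 * m + 1) ^ CARD('n))"] by simp
  also have "\<dots> \<le> (25 * real CARD('n) * (real k + 1) ^ 3) ^ CARD('n)"
  proof -
    have "1 \<le> CARD('n) * (k + 1) ^ 3" by simp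
    then have "2 * m + 1 \<le> 25 * CARD('n) * (k + 1) ^ 3"
      unfolding m_def by linarith
    then have "real (2 * m + 1) \<le> real (25 * CARD('n) * (k + 1) ^ 3)"
      by (rule of_nat_mono)
    then have "real (2 * m + 1) \<le> 25 * real CARD('n) * (real k + 1) ^ 3"
      by (simp add: add.commute)
    then show ?thesis
      unfolding of_nat_power by (rule power_mono) simp
  qed
  also have "\<dots> = (25 * real CARD('n)) ^ CARD('n) * (real k + 1) ^ (3 * CARD('n))"
    by (simp add: power_mult_distrib power_mult)
  finally have "M\<^sup>2 \<le> 4 * (25 * real CARD('n)) ^ CARD('n) / S * (real k + 1) ^ (3 * CARD('n))"
    using S by (simp add: field_simps)
  moreover have "M \<le> 1 + M\<^sup>2"
    using sum_power2_ge_zero[of "M - 1/2" 0] by (simp add: power2_eq_square algebra_simps)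
  moreover have "1 \<le> (real k + 1) ^ (3 * CARD('n))"
    by (rule one_le_power) simp
  ultimately have "M \<le> K * (real k + 1) ^ (3 * CARD('n))"
    unfolding K_def distrib_right by linarith
  then show "norm (p \<theta>) \<le> K * (real k + 1) ^ (3 * CARD('n))"
    using \<theta>0(2)[OF \<theta>] by (simp add: M_def)
qed

end

section \<open>Polynomial weights and double series\<close>

lemma summable_poly_times_geometric:
  fixes \<rho> :: real
  assumes "0 \<le> \<rho>" "\<rho> < 1"
  shows "summable (\<lambda>k. (real k + 1) ^ s * \<rho> ^ k)"
proof -
  have "summable (\<lambda>k. (real k + 1) ^ s * x ^ k)" if "norm x < 1" for x :: real
    using that
  proof (induction s arbitrary: x)
    case (Suc s)
    \<comment> \<open>Formal differentiation of a power series keeps its disc of convergence; here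
      it yields the coefficients \<open>(k + 1) * (k + 2) ^ s\<close>, which dominate
      \<open>(k + 1) ^ Suc s\<close>. The induction runs over all \<open>x\<close> in the disc for
      this reason.\<close>
    have "summable (\<lambda>k. diffs (\<lambda>k. (real k + 1) ^ s) k * \<bar>x\<bar> ^ k)"
      using Suc.IH Suc.prems by (intro termdiff_converges[of _ 1]) auto
    then show ?case
    proof (rule summable_comparison_test'[where N = 0])
      fix k
      have "(real k + 1) ^ s \<le> (real (Suc k) + 1) ^ s"
        by (intro power_mono) auto
      then show "norm ((real k + 1) ^ Suc s * x ^ k) \<le> diffs (\<lambda>k. (real k + 1) ^ s) k * \<bar>x\<bar> ^ k"
        by (auto simp: diffs_def abs_mult power_abs intro!: mult_mono)
    qed
  qed simp
  then show ?thesis using assms by simp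
qed

lemma summable_on_product_nonneg:
  fixes f g :: "nat \<Rightarrow> real"
  assumes "summable f" "summable g" "\<And>k. 0 \<le> f k" "\<And>j. 0 \<le> g j"
  shows "(\<lambda>(k, j). f k * g j) summable_on UNIV"
proof -
  have "(\<lambda>(k, j). f k * g j) summable_on Sigma UNIV (\<lambda>_. UNIV)"
  proof (rule summable_on_SigmaI)
    show "((\<lambda>j. case (k, j) of (k, j) \<Rightarrow> f k * g j) has_sum f k * suminf g) UNIV" for k
      using assms by (auto intro!: sums_nonneg_imp_has_sum sums_mult)
    show "(\<lambda>k. f k * suminf g) summable_on UNIV"
      using assms by (subst summable_on_UNIV_nonneg_real_iff)
        (auto intro!: summable_mult2 mult_nonneg_nonneg suminf_nonneg)
  qed (use assms in auto)
  then show ?thesis by simp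
qed

lemma summable_prod_decode:
  fixes f g :: "nat \<Rightarrow> real"
  assumes "summable f" "summable g" "\<And>k. 0 \<le> f k" "\<And>j. 0 \<le> g j"
  shows "summable (\<lambda>n. f (fst (prod_decode n)) * g (snd (prod_decode n)))"
  using summable_on_product_nonneg[OF assms]
    summable_on_reindex_bij_betw[OF bij_prod_decode, of "\<lambda>(k, j). f k * g j"]
  by (intro summable_on_imp_summable) (simp add: case_prod_beta)

text \<open>Under absolute convergence the iterated series and the enumerated one both equal the
  unordered sum over all pairs. The enumeration brings the double series into the single-index form
  required for termwise differentiation.\<close>

lemma suminf_suminf_prod_decode:
  fixes b :: "nat \<Rightarrow> nat \<Rightarrow> 'a::banach"
  assumes f: "summable f" "\<And>k. 0 \<le> f k" and g: "summable g" "\<And>j. 0 \<le> g j"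
    and le: "\<And>k j. norm (b k j) \<le> f k * g j"
  shows "(\<Sum>k. \<Sum>j. b k j) = (\<Sum>n. case prod_decode n of (k, j) \<Rightarrow> b k j)"
proof -
  have infsum_eq: "infsum h UNIV = suminf h" if "summable (\<lambda>n. norm (h n))" for h :: "nat \<Rightarrow> 'a"
    using norm_summable_imp_has_sum[OF that summable_sums[OF summable_norm_cancel[OF that]]]
    by (rule infsumI)
  have inner: "summable (\<lambda>j. norm (b k j))" for k
    using le by (intro summable_comparison_test'[OF summable_mult[OF g(1), of "f k"]]) auto
  have outer: "summable (\<lambda>k. norm (\<Sum>j. b k j))"
  proof (rule summable_comparison_test'[OF summable_mult2[OF f(1), of "suminf g"]])
    fix k
    have "norm (\<Sum>j. b k j) \<le> (\<Sum>j. f k * g j)"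
      by (rule norm_suminf_le[OF le summable_mult[OF g(1)]])
    then show "norm (norm (\<Sum>j. b k j)) \<le> f k * suminf g"
      using suminf_mult[OF g(1)] by simp
  qed
  have enum: "summable (\<lambda>n. norm (case prod_decode n of (k, j) \<Rightarrow> b k j))"
    using le by (intro summable_comparison_test'[OF summable_prod_decode[OF f(1) g(1) f(2) g(2)]])
      (simp add: case_prod_beta)
  have "(\<lambda>(k, j). b k j) abs_summable_on UNIV"
    using summable_on_product_nonneg[OF f(1) g(1) f(2) g(2)]
    by (rule summable_on_comparison_test) (use le in auto)
  then have "(\<lambda>(k, j). b k j) summable_on Sigma UNIV (\<lambda>_. UNIV)"
    using abs_summable_summable by simp
  then have "(\<Sum>\<^sub>\<infinity>k. \<Sum>\<^sub>\<infinity>j. b k j) = infsum (\<lambda>(k, j). b k j) UNIV"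
    using infsum_Sigma'_banach[of b UNIV "\<lambda>_. UNIV"] by simp
  then show ?thesis
    using infsum_reindex_bij_betw[OF bij_prod_decode, of "\<lambda>(k, j). b k j"]
    by (simp add: infsum_eq[OF inner] infsum_eq[OF outer] infsum_eq[OF enum])
qed

section \<open>Smoothness and invariance of Hardy space functions\<close>

theorem corollary22:
  fixes \<sigma> :: "(real^'n::finite) measure"
    and Y :: "nat \<Rightarrow> nat \<Rightarrow> real^'n \<Rightarrow> complex"
  assumes "CARD('n) \<ge> 2"
    and "rotation_invariant_sphere_measure \<sigma>"
    and "\<And>k. harmonic_orthonormal_basis \<sigma> k (Y k)"
  shows "polyharmonic_hardy Y \<subseteq> C_inf_klein_dirac"
proof
  fix f assume "f \<in> polyharmonic_hardy Y"
  define a where "a k = harmonic_dim TYPE('n) k" for k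
  define q where "q = 3 * CARD('n)"
  obtain c where summable_c: "(\<lambda>(k, l, j). (norm (c k l j))\<^sup>2) summable_on {(k, l, j). l \<in> {1..a k}}"
    and f_eq: "\<And>z \<theta>. z \<in> ball 0 1 \<Longrightarrow> \<theta> \<in> sphere 0 1 \<Longrightarrow>
      f (z, \<theta>) = (\<Sum>k. \<Sum>l = 1..a k. \<Sum>j. c k l j * z ^ (k + 2 * j) * Y k l \<theta>)"
    using \<open>f \<in> polyharmonic_hardy Y\<close> unfolding polyharmonic_hardy_def a_def by blast
  \<comment> \<open>Square summability enters through a uniform bound: a single square is at most
    the whole sum, and \<open>t \<le> 1 + t\<^sup>2\<close>.\<close>
  obtain C where C: "C \<ge> 0" "\<And>k l j. l \<in> {1..a k} \<Longrightarrow> norm (c k l j) \<le> C"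
  proof
    let ?A = "{(k, l, j). l \<in> {1..a k}}" and ?h = "\<lambda>(k, l, j). (norm (c k l j))\<^sup>2"
    show "1 + infsum ?h ?A \<ge> 0"
      by (auto intro!: add_nonneg_nonneg infsum_nonneg)
    fix k l j assume "l \<in> {1..a k}"
    then have "(norm (c k l j))\<^sup>2 \<le> infsum ?h ?A"
      using finite_sum_le_infsum[OF summable_c, of "{(k, l, j)}"] by auto
    moreover have "norm (c k l j) \<le> 1 + (norm (c k l j))\<^sup>2"
      using sum_power2_ge_zero[of "norm (c k l j) - 1/2" 0]
      by (simp add: power2_eq_square algebra_simps)
    ultimately show "norm (c k l j) \<le> 1 + infsum ?h ?A" by linarith
  qed
  have Y: "Y k l \<in> homogeneous_polys k" "(LINT \<theta>|\<sigma>. Y k l \<theta> * cnj (Y k l \<theta>)) = 1"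
    if "l \<in> {1..a k}" for k l
  proof -
    have "Y k l \<in> cfun.span (Y k ` {1..a k})"
      using that by (intro cfun.span_base) auto
    then show "Y k l \<in> homogeneous_polys k"
      using assms(3)[of k]
      by (auto simp: harmonic_orthonormal_basis_def Let_def harmonic_polys_def a_def)
    show "(LINT \<theta>|\<sigma>. Y k l \<theta> * cnj (Y k l \<theta>)) = 1"
      using assms(3)[of k] that by (simp add: harmonic_orthonormal_basis_def Let_def a_def)
  qed
  obtain K where K: "K \<ge> 0"
    "\<And>k p \<theta>. p \<in> homogeneous_polys k \<Longrightarrow> (LINT \<theta>|\<sigma>. p \<theta> * cnj (p \<theta>)) = 1 \<Longrightarrow>
      \<theta> \<in> sphere 0 1 \<Longrightarrow> norm (p \<theta>) \<le> K * (real k + 1) ^ q"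
    unfolding q_def using homogeneous_polys_sup_bound[OF assms(1,2)] by blast
  have Y_bound: "norm (Y k l x) \<le> K * (real k + 1) ^ q * norm x ^ k" if "l \<in> {1..a k}" for k l x
    using K(2) Y[OF that] by (intro homogeneous_polys_norm_le) auto
  \<comment> \<open>The finite sum over \<open>l\<close> is absorbed into one polynomial on the
    ambient space. Its degree is at most \<open>(k + 2 * j) + k\<close>, from the power of
    \<open>z\<close> and from \<open>Y k l\<close>.\<close>
  define b where "b k j w = (\<Sum>l = 1..a k. c k l j * fst w ^ (k + 2 * j) * Y k l (snd w))" for k j w
  have b_poly: "poly_deg (2 * k + 2 * j) (b k j)" for k j
    unfolding b_def
  proof (rule poly_deg_sum)
    fix l assume l: "l \<in> {1..a k}"
    have "poly_deg (0 + (k + 2 * j) * 1 + k)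
        (\<lambda>w :: complex \<times> (real^'n). c k l j * fst w ^ (k + 2 * j) * Y k l (snd w))"
      by (intro poly_deg.mult poly_deg.const poly_deg_power poly_deg.linear bounded_linear_fst
          poly_deg_compose_linear[OF _ bounded_linear_snd] homogeneous_polys_poly_deg Y(1) l)
    then show "poly_deg (2 * k + 2 * j)
        (\<lambda>w :: complex \<times> (real^'n). c k l j * fst w ^ (k + 2 * j) * Y k l (snd w))"
      by (rule poly_deg.mono) simp
  qed simp
  have f_eq_b: "f (z, \<theta>) = (\<Sum>k. \<Sum>j. b k j (z, \<theta>))" if z: "z \<in> ball 0 1" and \<theta>: "\<theta> \<in> sphere 0 1" for z \<theta>
  proof -
    have "(\<Sum>l = 1..a k. \<Sum>j. c k l j * z ^ (k + 2 * j) * Y k l \<theta>) = (\<Sum>j. b k j (z, \<theta>))" for k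
      unfolding b_def fst_conv snd_conv
    proof (rule suminf_sum[symmetric])
      fix l assume l: "l \<in> {1..a k}"
      have "summable (\<lambda>j. C * norm (Y k l \<theta>) * norm z ^ j)"
        using z by (intro summable_mult) auto
      then show "summable (\<lambda>j. c k l j * z ^ (k + 2 * j) * Y k l \<theta>)"
      proof (rule summable_comparison_test'[where N = 0])
        fix j
        have "norm z ^ (k + 2 * j) \<le> norm z ^ j"
          using z by (intro power_decreasing) auto
        then have "norm (c k l j) * norm z ^ (k + 2 * j) \<le> C * norm z ^ j"
          using C l by (intro mult_mono) auto
        then have "norm (c k l j) * norm z ^ (k + 2 * j) * norm (Y k l \<theta>) \<le> C * norm z ^ j * norm (Y k l \<theta>)"
          by (rule mult_right_mono) simp
        then show "norm (c k l j * z ^ (k + 2 * j) * Y k l \<theta>) \<le> C * norm (Y k l \<theta>) * norm z ^ j"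
          by (simp add: norm_mult norm_power mult_ac)
      qed
    qed
    then show ?thesis
      using f_eq[OF z \<theta>] by simp
  qed
  have "\<exists>U F. open U \<and> (z0, \<theta>0) \<in> U \<and> C_inf_on U F \<and> (\<forall>w\<in>U \<inter> ball 0 1 \<times> sphere 0 1. F w = f w)"
    if z0: "z0 \<in> ball 0 1" and \<theta>0: "\<theta>0 \<in> sphere 0 1" for z0 \<theta>0
  proof -
    \<comment> \<open>On the \<open>\<delta>\<close>-ball around the point,
      \<open>norm z \<le> r\<close> and \<open>norm x \<le> 1 + \<delta>\<close>, so
      \<open>\<rho>\<close> bounds the product. Since \<open>r = 1 - \<delta>\<close>, one gets
      \<open>\<rho> = 1 - \<delta>\<^sup>2 < 1\<close>.\<close>
    define \<delta> where "\<delta> = (1 - norm z0) / 2"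
    define r where "r = norm z0 + \<delta>"
    define \<rho> where "\<rho> = r * (1 + \<delta>)"
    have \<delta>: "0 < \<delta>" using z0 by (simp add: \<delta>_def)
    then have r: "0 \<le> r" "r \<le> \<rho>"
      by (auto simp: r_def \<rho>_def algebra_simps)
    have "1 - \<rho> = \<delta>\<^sup>2"
      by (simp add: \<rho>_def r_def \<delta>_def power2_eq_square field_simps)
    then have "\<rho> < 1" using \<delta> by (smt (verit) zero_less_power)
    \<comment> \<open>Collects the coefficient bound \<open>C\<close>, the sup bound of the
      \<open>Y k l\<close> and the number of indices \<open>l\<close>.\<close>
    define A where "A k = K * C * (real k + 1) ^ (CARD('n) + q) * \<rho> ^ k" for k
    have A_nonneg: "0 \<le> A k" for k
      using K(1) C(1) r by (simp add: A_def)
    have b_bound: "norm (b k j w) \<le> A k * \<rho> ^ j" if w: "w \<in> cball (z0, \<theta>0) \<delta>" for k j w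
    proof -
      have "dist z0 (fst w) \<le> \<delta>" "dist \<theta>0 (snd w) \<le> \<delta>"
        using w dist_fst_le[of "(z0, \<theta>0)" w] dist_snd_le[of "(z0, \<theta>0)" w] by auto
      then have nz: "norm (fst w) \<le> r" and nx: "norm (snd w) \<le> 1 + \<delta>"
        using \<theta>0 norm_triangle_ineq2[of "fst w" z0] norm_triangle_ineq2[of "snd w" \<theta>0]
        by (auto simp: r_def dist_norm norm_minus_commute)
      have "norm (c k l j * fst w ^ (k + 2 * j) * Y k l (snd w)) \<le>
          C * (r ^ k * \<rho> ^ j) * (K * (real k + 1) ^ q * (1 + \<delta>) ^ k)" if l: "l \<in> {1..a k}" for l
      proof -
        \<comment> \<open>The factor \<open>r ^ k\<close> is kept to combine with
          \<open>(1 + \<delta>) ^ k\<close> from \<open>Y k l\<close> into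
          \<open>\<rho> ^ k\<close>; the remaining \<open>r ^ (2 * j)\<close> is weakened to
          \<open>\<rho> ^ j\<close>.\<close>
        have "norm (fst w) ^ (k + 2 * j) \<le> r ^ k * r ^ (2 * j)"
          using nz by (simp add: power_mono flip: power_add)
        also have "r ^ (2 * j) \<le> \<rho> ^ (2 * j)"
          using r by (intro power_mono) auto
        also have "\<rho> ^ (2 * j) \<le> \<rho> ^ j"
          using r \<open>\<rho> < 1\<close> by (intro power_decreasing) auto
        finally have *: "norm (fst w) ^ (k + 2 * j) \<le> r ^ k * \<rho> ^ j"
          using r by (simp add: mult_left_mono)
        have "norm (Y k l (snd w)) \<le> K * (real k + 1) ^ q * norm (snd w) ^ k"
          by (rule Y_bound[OF l])
        also have "\<dots> \<le> K * (real k + 1) ^ q * (1 + \<delta>) ^ k"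
          using nx K(1) by (intro mult_left_mono power_mono) auto
        finally show ?thesis
          unfolding norm_mult norm_power using C(1) C(2)[OF l] r *
          by (intro mult_mono) auto
      qed
      then have "norm (b k j w) \<le> (\<Sum>l = 1..a k. C * (r ^ k * \<rho> ^ j) * (K * (real k + 1) ^ q * (1 + \<delta>) ^ k))"
        unfolding b_def by (rule sum_norm_le)
      also have "\<dots> = real (a k) * (K * C * (real k + 1) ^ q * \<rho> ^ k * \<rho> ^ j)"
        by (simp add: \<rho>_def power_mult_distrib mult_ac)
      also have "\<dots> \<le> (real k + 1) ^ CARD('n) * (K * C * (real k + 1) ^ q * \<rho> ^ k * \<rho> ^ j)"
      proof (rule mult_right_mono)
        have "real (a k) \<le> real ((k + 1) ^ CARD('n))"
          unfolding a_def by (rule of_nat_mono[OF harmonic_dim_le])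
        then show "real (a k) \<le> (real k + 1) ^ CARD('n)" by (simp add: add.commute)
      qed (use K(1) C(1) r in auto)
      also have "\<dots> = A k * \<rho> ^ j"
        by (simp add: A_def power_add mult_ac)
      finally show ?thesis .
    qed
    have summable_A: "summable (\<lambda>k. A k * (2 * (real k + 1)) ^ m)" for m
    proof -
      have eq: "A k * (2 * (real k + 1)) ^ m =
          K * C * 2 ^ m * ((real k + 1) ^ (CARD('n) + q + m) * \<rho> ^ k)" for k
        by (simp only: A_def power_add power_mult_distrib mult_ac)
      show ?thesis
        unfolding eq using r \<open>\<rho> < 1\<close>
        by (intro summable_mult summable_poly_times_geometric) auto
    qed
    have summable_\<rho>: "summable (\<lambda>j. \<rho> ^ j * (2 * (real j + 1)) ^ m)" for m
    proof -
      have eq: "\<rho> ^ j * (2 * (real j + 1)) ^ m = 2 ^ m * ((real j + 1) ^ m * \<rho> ^ j)" for j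
        by (simp only: power_mult_distrib mult_ac)
      show ?thesis
        unfolding eq using r \<open>\<rho> < 1\<close>
        by (intro summable_mult summable_poly_times_geometric) auto
    qed
    define d where "d n = (case prod_decode n of (k, j) \<Rightarrow> 2 * k + 2 * j)" for n
    define u where "u n w = (case prod_decode n of (k, j) \<Rightarrow> b k j w)" for n w
    define F where "F w = (\<Sum>n. u n w)" for w
    \<comment> \<open>The bounds hold up to radius \<open>\<delta>\<close>; halving it leaves the
      strict margin for Bernstein's inequality.\<close>
    have "C_k_on m (ball (z0, \<theta>0) (\<delta> / 2)) F" for m
      unfolding F_def
    proof (rule C_k_on_suminf_poly_deg)
      let ?M = "\<lambda>n. A (fst (prod_decode n)) * \<rho> ^ snd (prod_decode n)"
      show "poly_deg (d n) (u n)" for n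
        unfolding d_def u_def using b_poly by (simp add: case_prod_beta)
      show "norm (u n w) \<le> ?M n" if "w \<in> cball (z0, \<theta>0) \<delta>" for n w
        unfolding u_def using b_bound[OF that] by (simp add: case_prod_beta)
      show "summable (\<lambda>n. ?M n * (real (d n) + 1) ^ m)" for m
      proof (rule summable_comparison_test'[OF summable_prod_decode[OF summable_A[of m] summable_\<rho>[of m]]])
        fix n
        obtain k j where n: "prod_decode n = (k, j)" by fastforce
        \<comment> \<open>The degree weight is split into a product, so that the sums over
          \<open>k\<close> and \<open>j\<close> separate.\<close>
        have "real (d n) + 1 \<le> (2 * (real k + 1)) * (2 * (real j + 1))"
          by (simp add: d_def n algebra_simps)
        then have "(real (d n) + 1) ^ m \<le> (2 * (real k + 1)) ^ m * (2 * (real j + 1)) ^ m"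
          by (metis power_mono power_mult_distrib add_nonneg_nonneg of_nat_0_le_iff zero_le_one)
        then have "A k * \<rho> ^ j * (real (d n) + 1) ^ m \<le>
            A k * \<rho> ^ j * ((2 * (real k + 1)) ^ m * (2 * (real j + 1)) ^ m)"
          using A_nonneg r by (intro mult_left_mono) auto
        then show "norm (?M n * (real (d n) + 1) ^ m) \<le>
            A (fst (prod_decode n)) * (2 * (real (fst (prod_decode n)) + 1)) ^ m *
            (\<rho> ^ snd (prod_decode n) * (2 * (real (snd (prod_decode n)) + 1)) ^ m)"
          using A_nonneg r by (simp add: n abs_mult mult_ac)
      qed (use A_nonneg r in auto)
    qed (use \<delta> in auto)
    moreover have "F w = f w" if w: "w \<in> ball (z0, \<theta>0) (\<delta> / 2) \<inter> ball 0 1 \<times> sphere 0 1" for w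
    proof -
      obtain z \<theta> where w_eq: "w = (z, \<theta>)" by fastforce
      have "f w = (\<Sum>k. \<Sum>j. b k j w)"
        using f_eq_b w unfolding w_eq by auto
      also have "\<dots> = F w"
        unfolding F_def u_def
      proof (rule suminf_suminf_prod_decode)
        show "summable A" using summable_A[of 0] by simp
        show "summable (\<lambda>j. \<rho> ^ j)" using summable_\<rho>[of 0] by simp
        show "norm (b k j w) \<le> A k * \<rho> ^ j" for k j
          using w \<delta> by (intro b_bound) auto
      qed (use A_nonneg r in auto)
      finally show ?thesis by simp
    qed
    ultimately show ?thesis
      using \<delta> by (intro exI[of _ "ball (z0, \<theta>0) (\<delta> / 2)"] exI[of _ F]) (auto simp: C_inf_on_def)
  qed
  then have "smooth_on_submanifold (ball 0 1 \<times> sphere 0 1) f"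
    unfolding smooth_on_submanifold_def by blast
  moreover have "f (- z, - \<theta>) = f (z, \<theta>)" if z: "z \<in> ball 0 1" and \<theta>: "\<theta> \<in> sphere 0 1" for z \<theta>
  proof -
    \<comment> \<open>Both \<open>z ^ (k + 2 * j)\<close> and \<open>Y k l\<close> pick up the sign
      \<open>(- 1) ^ k\<close>, and the two signs cancel.\<close>
    have "b k j (- z, - \<theta>) = b k j (z, \<theta>)" for k j
      unfolding b_def
    proof (rule sum.cong)
      fix l assume "l \<in> {1..a k}"
      then have "Y k l (- \<theta>) = (- 1) ^ k * Y k l \<theta>"
        using homogeneous_polys_scaleR[OF Y(1), of l k "- 1" \<theta>] by simp
      moreover have "(- z) ^ (k + 2 * j) = (- 1) ^ k * z ^ (k + 2 * j)"
        by (simp add: power_add power_minus[of z k])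
      ultimately show "c k l j * fst (- z, - \<theta>) ^ (k + 2 * j) * Y k l (snd (- z, - \<theta>)) =
          c k l j * fst (z, \<theta>) ^ (k + 2 * j) * Y k l (snd (z, \<theta>))"
        by simp
    qed simp
    then show ?thesis
      using f_eq_b[of z \<theta>] f_eq_b[of "- z" "- \<theta>"] z \<theta> by simp
  qed
  ultimately show "f \<in> C_inf_klein_dirac"
    by (simp add: C_inf_klein_dirac_def)
qed

end
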